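(* Let $F$ be a field of prime characteristic $p$ and let $\alpha,\delta_1,\dots,\delta_{p-1}\in F$, where $\alpha\neq 0$. Then the $p\times p$ matrix $D$ over $F$ defined by $$D=\begin{pmatrix} 0 & \alpha & 0 & \dots & \dots & 0\\ \delta_1 & 0 & 2\alpha & \dots & \dots & 0\\ \delta_2 & \delta_1 & 0 & 3\alpha & \dots & 0\\ \vdots & \ddots & \ddots & \ddots & \ddots & \vdots\\ \delta_{p-2} & \dots & \delta_2 & \delta_1 & 0 & (p-1)\alpha\\ \delta_{p-1} & \delta_{p-2} & \dots & \delta_2 & \delta_1 & 0 \end{pmatrix}$$ (that is, $D_{i,i}=0$, $D_{i,i+1}=i\alpha$ for $1\le i\le p-1$, $D_{i,j}=\delta_{i-j}$ for $i>j$, and $D_{i,j}=0$ for $j>i+1$) is similar over $F$ to the companion matrix of the polynomial $X^p-|D|$. In particular, if $F$ is perfect, then $D$ is similar to the Jordan block $J_p(|D|^{1/p})$.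
   Context: $|D|$ denotes the determinant of $D$. $J_p(\lambda)$ denotes the $p\times p$ Jordan block with eigenvalue $\lambda$. If $F$ is perfect of characteristic $p$, $|D|^{1/p}$ denotes the unique $p$-th root of $|D|$ in $F$. *)

theory Defs
  imports
    "Jordan_Normal_Form.Jordan_Normal_Form"
    "HOL-Algebra.Algebraic_Closure_Type"
begin

text \<open>Companion matrix of a monic polynomial, in the convention with ones on the subdiagonal and
  the negated coefficients in the last column.\<close>

definition companion_mat :: "'a :: comm_ring_1 poly \<Rightarrow> 'a mat" where
  "companion_mat f = (let n = Polynomial.degree f in
     mat n n (\<lambda>(i, j). if Suc j = n then - Polynomial.coeff f i
                        else if i = Suc j then 1 else 0))"

text \<open>A field is perfect if every irreducible polynomial over it is separable, i.e. has only
  simple roots in an algebraic closure.\<close>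

definition perfect_field :: "'a :: field itself \<Rightarrow> bool" where
  "perfect_field _ \<longleftrightarrow>
     (\<forall>f :: 'a poly. Factorial_Ring.irreducible f \<longrightarrow> rsquarefree (map_poly to_ac f))"

text \<open>Only meaningful where existence and uniqueness hold; for perfect fields of prime
  characteristic see \<open>char_root_power\<close> and \<open>char_root_unique\<close> below.\<close>

definition char_root :: "'a :: field \<Rightarrow> 'a" where
  "char_root a = (THE c. c ^ CHAR('a) = a)"

lemma power_CHAR_inj:
  fixes x y :: "'a :: field"
  assumes "Factorial_Ring.prime CHAR('a)" and "x ^ CHAR('a) = y ^ CHAR('a)"
  shows "x = y"
proof -
  have "((x - y) + y) ^ CHAR('a) = (x - y) ^ CHAR('a) + y ^ CHAR('a)"
    by (rule freshmans_dream[OF assms(1) refl])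
  with assms(2) have "(x - y) ^ CHAR('a) = 0" by simp
  then show ?thesis by simp
qed

lemma perfect_field_root_exists:
  fixes a :: "'a :: field"
  assumes p: "Factorial_Ring.prime CHAR('a)" and perf: "perfect_field TYPE('a)"
  shows "\<exists>c. c ^ CHAR('a) = a"
proof -
  interpret h: map_poly_inj_comm_ring_hom "to_ac :: 'a \<Rightarrow> 'a alg_closure"
    by unfold_locales auto
  have p0: "CHAR('a) > 0" using p prime_gt_0_nat by blast
  define f where "f = Polynomial.monom (1 :: 'a) CHAR('a) - [:a:]"
  have poly_f: "poly f x = x ^ CHAR('a) - a" for x
    by (simp add: f_def poly_monom)
  have hc: "map_poly to_ac [:a:] = [:to_ac a:]"
    by (rule Polynomial.poly_eqI) (simp add: coeff_map_poly coeff_pCons split: nat.split)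
  have poly_hf: "poly (map_poly to_ac f) z = z ^ CHAR('a) - to_ac a" for z
    by (simp add: f_def poly_monom h.hom_minus hc)
  have "Polynomial.coeff f CHAR('a) = 1"
    using p0 by (cases "CHAR('a)") (auto simp: f_def)
  then have deg_f: "Polynomial.degree f > 0"
    using p0 le_degree[of f "CHAR('a)"] by simp
  define q where "q = arg_min Polynomial.degree (\<lambda>q. q dvd f \<and> Polynomial.degree q > 0)"
  have q: "q dvd f" "Polynomial.degree q > 0"
    and q_min: "\<And>r. r dvd f \<Longrightarrow> Polynomial.degree r > 0 \<Longrightarrow> Polynomial.degree q \<le> Polynomial.degree r"
    using arg_min_nat_lemma[of "\<lambda>q. q dvd f \<and> Polynomial.degree q > 0" f Polynomial.degree] deg_f
    by (auto simp: q_def)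
  have q0: "q \<noteq> 0" using q(2) by auto
  have "Factorial_Ring.irreducible q"
  proof (rule Factorial_Ring.irreducibleI)
    show "q \<noteq> 0" by fact
    show "\<not> is_unit q" using q(2) is_unit_iff_degree[OF q0] by simp
    fix r s assume rs: "q = r * s"
    show "is_unit r \<or> is_unit s"
    proof (rule ccontr)
      assume "\<not> (is_unit r \<or> is_unit s)"
      moreover have rs0: "r \<noteq> 0" "s \<noteq> 0" using rs q0 by auto
      ultimately have "Polynomial.degree r > 0" "Polynomial.degree s > 0"
        using is_unit_iff_degree[OF rs0(1)] is_unit_iff_degree[OF rs0(2)] by simp_all
      moreover have "r dvd f" using q(1) dvd_mult_left[of r s f] unfolding rs by simp
      moreover have "Polynomial.degree q = Polynomial.degree r + Polynomial.degree s"
        using rs rs0 by (simp add: degree_mult_eq)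
      ultimately show False using q_min[of r] by simp
    qed
  qed
  with perf have sf: "rsquarefree (map_poly to_ac q)" by (auto simp: perfect_field_def)
  have root: "z ^ CHAR('a) = to_ac a" if "poly (map_poly to_ac q) z = 0" for z
  proof -
    obtain r where "f = q * r" using q(1) by blast
    then have "poly (map_poly to_ac f) z = 0" using that by (simp add: h.hom_mult)
    then show ?thesis by (simp add: poly_hf)
  qed
  have "Polynomial.degree (map_poly to_ac q) > 0" using q(2) by simp
  then obtain b where b: "poly (map_poly to_ac q) b = 0"
    using alg_closed_imp_poly_has_root by blast
  then obtain s where s: "map_poly to_ac q = [:-b, 1:] * s"
    using poly_eq_0_iff_dvd by blast
  have s0: "s \<noteq> 0" using s q0 by auto
  have "Polynomial.degree s = 0"
  proof (rule ccontr)
    assume "Polynomial.degree s \<noteq> 0"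
    then obtain z where z: "poly s z = 0" using alg_closed_imp_poly_has_root by blast
    then have "poly (map_poly to_ac q) z = 0" by (simp add: s)
    then have "z ^ CHAR('a) = b ^ CHAR('a)" using root b by simp
    then have "z = b" using power_CHAR_inj[of z b] p by simp
    then have "[:-b, 1:] dvd s" using z poly_eq_0_iff_dvd by blast
    then have "[:-b, 1:] ^ 2 dvd map_poly to_ac q"
      unfolding s power2_eq_square by (rule mult_dvd_mono[OF dvd_refl])
    moreover have "map_poly to_ac q \<noteq> 0" using q0 by simp
    ultimately have "2 \<le> Polynomial.order b (map_poly to_ac q)"
      using order_divides[of b 2 "map_poly to_ac q"] by blast
    moreover have "Polynomial.order b (map_poly to_ac q) = 0 \<or> Polynomial.order b (map_poly to_ac q) = 1"
      using sf unfolding rsquarefree_def by blast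
    ultimately show False by linarith
  qed
  then have "Polynomial.degree (map_poly to_ac q) = 1"
    using s s0 by (simp add: degree_mult_eq del: mult_pCons_left)
  then have q1: "Polynomial.degree q = 1" by simp
  define c where "c = - Polynomial.coeff q 0 / Polynomial.coeff q 1"
  have "Polynomial.coeff q 1 \<noteq> 0" using q1 q0 by (metis leading_coeff_0_iff)
  moreover have "poly q c = Polynomial.coeff q 0 + Polynomial.coeff q 1 * c"
    by (simp add: poly_altdef q1)
  ultimately have "poly q c = 0" by (simp add: c_def)
  then have "poly f c = 0" using q(1) by auto
  then show ?thesis by (auto simp: poly_f)
qed

lemma char_root_unique:
  fixes a :: "'a :: field"
  assumes "Factorial_Ring.prime CHAR('a)" and "c ^ CHAR('a) = a"
  shows "char_root a = c"
  unfolding char_root_def using assms power_CHAR_inj by blast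

lemma char_root_power:
  fixes a :: "'a :: field"
  assumes "Factorial_Ring.prime CHAR('a)" and "perfect_field TYPE('a)"
  shows "char_root a ^ CHAR('a) = a"
  using perfect_field_root_exists[OF assms, of a] char_root_unique[OF assms(1)] by metis

end

theory Submission
  imports Defs
begin

text \<open>On \<open>V = F[x]/(x\<^sup>p)\<close> the matrix \<open>D\<close> is the operator \<open>\<alpha> d/dx + g\<close> with \<open>g = \<Sum> \<delta>\<^sub>k x\<^sup>k\<close>.
  If \<open>S\<close> is multiplication by \<open>x\<close>, then \<open>DS - SD = \<alpha>\<close>, hence
  \<open>D\<^sup>p S - S D\<^sup>p = p \<alpha> D\<^sup>p\<^sup>-\<^sup>1 = 0\<close>, so row 0 of \<open>D\<^sup>p\<close> is \<open>(c, 0, \<dots>, 0)\<close>. As \<open>D\<^sup>p\<close> also commutes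
  with \<open>D\<close>, whose superdiagonal has no zeros, \<open>D\<^sup>p = c\<close>; taking determinants, \<open>|D|\<^sup>p = c\<^sup>p\<close> and so
  \<open>|D| = c\<close>. The last unit vector is cyclic for every Hessenberg matrix with nonzero
  superdiagonal, so both \<open>D\<close> and the Jordan block of the \<open>p\<close>-th root of \<open>c\<close> are similar to the
  companion matrix of \<open>X\<^sup>p - c\<close>.\<close>

section \<open>Matrix entries, powers and similarity\<close>

lemma mult_mat_entry:
  assumes "A \<in> carrier_mat n m" "B \<in> carrier_mat m k" "i < n" "j < k"
  shows "(A * B) $$ (i, j) = (\<Sum>l<m. A $$ (i, l) * B $$ (l, j))"
  using assms by (simp add: scalar_prod_def atLeast0LessThan)

lemma sum_eq_single:
  assumes "finite A" "x \<in> A" "\<And>y. y \<in> A \<Longrightarrow> y \<noteq> x \<Longrightarrow> f y = 0"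
  shows "sum f A = f x"
  using sum.remove[OF assms(1,2), of f] assms(3) by simp

lemma pow_mat_Suc_left:
  assumes "A \<in> carrier_mat n n"
  shows "A ^\<^sub>m Suc k = A * A ^\<^sub>m k"
proof (induction k)
  case 0
  then show ?case using assms by simp
next
  case (Suc k)
  then show ?case
    using assms assoc_mult_mat[OF assms pow_carrier_mat[OF assms] assms, of k] by simp
qed

lemma det_pow_mat:
  fixes A :: "'a :: comm_ring_1 mat"
  assumes "A \<in> carrier_mat n n"
  shows "det (A ^\<^sub>m k) = det A ^ k"
proof (induction k)
  case 0
  then show ?case using assms by simp
next
  case (Suc k)
  then show ?case using det_mult[OF pow_carrier_mat[OF assms] assms] by (simp add: mult.commute)
qed

lemma similar_matI_intertwine:
  fixes A :: "'a :: field mat"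
  assumes A: "A \<in> carrier_mat n n" and B: "B \<in> carrier_mat n n" and P: "P \<in> carrier_mat n n"
    and det: "det P \<noteq> 0" and eq: "A * P = P * B"
  shows "similar_mat A B"
proof -
  \<comment> \<open>The argument \<open>()\<close> only fills the free slot of
    \<open>ring_mat\<close>; a unit of that ring has a two-sided inverse.\<close>
  obtain Q where Q: "Q \<in> carrier_mat n n" "Q * P = 1\<^sub>m n" "P * Q = 1\<^sub>m n"
    using det_non_zero_imp_unit[OF P det, of "()"] by (auto simp: Units_def ring_mat_def)
  have "P * B * Q = A * (P * Q)" using A P Q(1) by (simp add: eq[symmetric])
  then have "A = P * B * Q" using A Q(3) by simp
  then show ?thesis using A B P Q by (intro similar_matI[of A B P Q n]) auto
qed

section \<open>Cyclic vectors and companion form of Hessenberg matrices\<close>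

definition unreduced_hessenberg :: "nat \<Rightarrow> 'a :: zero mat \<Rightarrow> bool" where
  "unreduced_hessenberg n A \<longleftrightarrow> A \<in> carrier_mat n n \<and>
     (\<forall>i j. i < n \<longrightarrow> j < n \<longrightarrow> Suc i < j \<longrightarrow> A $$ (i, j) = 0) \<and>
     (\<forall>i. Suc i < n \<longrightarrow> A $$ (i, Suc i) \<noteq> 0)"

text \<open>Multiplying by \<open>A\<close> raises the topmost nonzero entry of a vector by exactly
  one row, scaling it by a superdiagonal entry. The last unit vector starts in row
  \<open>n - 1\<close>.\<close>

lemma unreduced_hessenberg_pow_last_col:
  fixes A :: "'a :: field mat"
  assumes A: "unreduced_hessenberg n A" and i: "i < n"
  shows "i + k < n - 1 \<Longrightarrow> (A ^\<^sub>m k) $$ (i, n - 1) = 0"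
    and "i + k = n - 1 \<Longrightarrow> (A ^\<^sub>m k) $$ (i, n - 1) \<noteq> 0"
proof -
  have carr: "A \<in> carrier_mat n n" and
    zero: "\<And>i j. i < n \<Longrightarrow> j < n \<Longrightarrow> Suc i < j \<Longrightarrow> A $$ (i, j) = 0" and
    nz: "\<And>i. Suc i < n \<Longrightarrow> A $$ (i, Suc i) \<noteq> 0"
    using A by (auto simp: unreduced_hessenberg_def)
  have step: "(A ^\<^sub>m Suc k) $$ (i, n - 1) = (\<Sum>l<n. A $$ (i, l) * (A ^\<^sub>m k) $$ (l, n - 1))"
    if "i < n" for i k
    using that by (simp only: pow_mat_Suc_left[OF carr])
      (rule mult_mat_entry[OF carr pow_carrier_mat[OF carr]], auto)
  have "(i + k < n - 1 \<longrightarrow> (A ^\<^sub>m k) $$ (i, n - 1) = 0) \<and>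
        (i + k = n - 1 \<longrightarrow> (A ^\<^sub>m k) $$ (i, n - 1) \<noteq> 0)"
    using i
  proof (induction k arbitrary: i)
    case 0
    then show ?case using carr by auto
  next
    case (Suc k)
    show ?case
    proof (intro conjI impI)
      assume less: "i + Suc k < n - 1"
      have "A $$ (i, l) * (A ^\<^sub>m k) $$ (l, n - 1) = 0" if "l < n" for l
        using zero[OF Suc.prems that] Suc.IH[OF that] less by (cases "Suc i < l") auto
      then show "(A ^\<^sub>m Suc k) $$ (i, n - 1) = 0"
        unfolding step[OF Suc.prems] by (intro sum.neutral) auto
    next
      assume eq: "i + Suc k = n - 1"
      then have Si: "Suc i < n" by simp
      \<comment> \<open>Hessenberg shape kills \<open>l > Suc i\<close>, the induction hypothesis
        kills \<open>l \<le> i\<close>.\<close>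
      have "A $$ (i, l) * (A ^\<^sub>m k) $$ (l, n - 1) = 0" if "l < n" "l \<noteq> Suc i" for l
        using zero[OF Suc.prems that(1)] Suc.IH[OF that(1)] eq that(2)
        by (cases "Suc i < l") auto
      then have "(A ^\<^sub>m Suc k) $$ (i, n - 1) = A $$ (i, Suc i) * (A ^\<^sub>m k) $$ (Suc i, n - 1)"
        unfolding step[OF Suc.prems] using Si by (intro sum_eq_single) auto
      then show "(A ^\<^sub>m Suc k) $$ (i, n - 1) \<noteq> 0"
        using nz[OF Si] Suc.IH[OF Si] eq by simp
    qed
  qed
  then show "i + k < n - 1 \<Longrightarrow> (A ^\<^sub>m k) $$ (i, n - 1) = 0"
    and "i + k = n - 1 \<Longrightarrow> (A ^\<^sub>m k) $$ (i, n - 1) \<noteq> 0" by auto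
qed

text \<open>The matrix vanishes above its antidiagonal and is nonzero on it, so a kernel vector has
  no last nonzero coordinate.\<close>

lemma det_krylov_nonzero:
  fixes A :: "'a :: field mat"
  assumes A: "unreduced_hessenberg n A"
  shows "det (mat n n (\<lambda>(i, k). (A ^\<^sub>m k) $$ (i, n - 1))) \<noteq> 0" (is "det ?P \<noteq> 0")
proof
  assume "det ?P = 0"
  then obtain v where v: "v \<in> carrier_vec n" "v \<noteq> 0\<^sub>v n" "?P *\<^sub>v v = 0\<^sub>v n"
    using det_0_iff_vec_prod_zero_field[of ?P n] by auto
  define k where "k = Max {k. k < n \<and> v $ k \<noteq> 0}"
  have "{k. k < n \<and> v $ k \<noteq> 0} \<noteq> {}"
    using v(1,2) by (auto simp: vec_eq_iff)
  then have "k \<in> {k. k < n \<and> v $ k \<noteq> 0}"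
    unfolding k_def by (intro Max_in) auto
  then have k: "k < n" "v $ k \<noteq> 0" by auto
  have max: "v $ l = 0" if "k < l" "l < n" for l
  proof (rule ccontr)
    assume "v $ l \<noteq> 0"
    then have "l \<le> k" unfolding k_def using that(2) by (intro Max_ge) auto
    then show False using that(1) by simp
  qed
  \<comment> \<open>Row \<open>i\<close> meets column \<open>k\<close> on the antidiagonal: columns
    before \<open>k\<close> are zero in this row, and \<open>v\<close> is zero after
    \<open>k\<close>.\<close>
  define i where "i = n - 1 - k"
  have i: "i < n" "i + k = n - 1" using k(1) by (auto simp: i_def)
  have "(A ^\<^sub>m l) $$ (i, n - 1) * v $ l = 0" if "l < n" "l \<noteq> k" for l
    using unreduced_hessenberg_pow_last_col(1)[OF A i(1), of l] max[of l] that i(2)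
    by (cases "k < l") auto
  then have "(\<Sum>l<n. (A ^\<^sub>m l) $$ (i, n - 1) * v $ l) = (A ^\<^sub>m k) $$ (i, n - 1) * v $ k"
    using k(1) by (intro sum_eq_single) auto
  moreover have "(?P *\<^sub>v v) $ i = (\<Sum>l<n. (A ^\<^sub>m l) $$ (i, n - 1) * v $ l)"
    using i(1) v(1) by (simp add: scalar_prod_def atLeast0LessThan)
  ultimately have "(?P *\<^sub>v v) $ i \<noteq> 0"
    using k(2) unreduced_hessenberg_pow_last_col(2)[OF A i] by simp
  then show False unfolding v(3) using i(1) by simp
qed

text \<open>In the basis \<open>e, A e, ..., A^(n-1) e\<close> the matrix \<open>A\<close> sends
  each vector to the next and the last one to \<open>A^n e = c e\<close>.\<close>

lemma unreduced_hessenberg_similar_companion: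
  fixes A :: "'a :: field mat"
  assumes A: "unreduced_hessenberg n A" and n: "n > 0" and pow: "A ^\<^sub>m n = c \<cdot>\<^sub>m 1\<^sub>m n"
  shows "similar_mat A (companion_mat (Polynomial.monom 1 n - [:c:]))"
proof -
  define C where "C = mat n n (\<lambda>(i, j). if Suc j = n then (if i = 0 then c else 0)
                                         else if i = Suc j then 1 else 0)"
  have "Polynomial.degree (Polynomial.monom 1 n - [:c:]) = n"
    using n by (simp add: diff_conv_add_uminus degree_add_eq_left degree_monom_eq
        del: add_uminus_conv_diff)
  then have C_eq: "companion_mat (Polynomial.monom 1 n - [:c:]) = C"
    using n by (auto simp: companion_mat_def C_def Let_def coeff_pCons split: nat.split)
  \<comment> \<open>The columns of \<open>P\<close> are \<open>A\<^sup>k e\<close> for the last unit vector \<open>e\<close>, which is cyclic for \<open>A\<close>.\<close>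
  define P where "P = mat n n (\<lambda>(i, k). (A ^\<^sub>m k) $$ (i, n - 1))"
  have carr: "A \<in> carrier_mat n n" "C \<in> carrier_mat n n" "P \<in> carrier_mat n n"
    using A by (auto simp: unreduced_hessenberg_def C_def P_def)
  have "A * P = P * C"
  proof (rule eq_matI)
    fix i k assume "i < dim_row (P * C)" "k < dim_col (P * C)"
    then have ik: "i < n" "k < n" using carr by auto
    have "(A * P) $$ (i, k) = (\<Sum>l<n. A $$ (i, l) * (A ^\<^sub>m k) $$ (l, n - 1))"
      unfolding mult_mat_entry[OF carr(1) carr(3) ik] using ik by (intro sum.cong) (auto simp: P_def)
    also have "\<dots> = (A ^\<^sub>m Suc k) $$ (i, n - 1)"
      unfolding pow_mat_Suc_left[OF carr(1)]
      using ik by (intro mult_mat_entry[OF carr(1) pow_carrier_mat[OF carr(1)], symmetric]) auto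
    finally have L: "(A * P) $$ (i, k) = (A ^\<^sub>m Suc k) $$ (i, n - 1)" .
    have R: "(P * C) $$ (i, k) = (\<Sum>l<n. P $$ (i, l) * C $$ (l, k))"
      by (rule mult_mat_entry[OF carr(3) carr(2) ik])
    show "(A * P) $$ (i, k) = (P * C) $$ (i, k)"
    proof (cases "Suc k = n")
      case True
      \<comment> \<open>The wrap-around column: column 0 of \<open>P\<close> is \<open>e\<close>
        itself, and \<open>pow\<close> turns \<open>A^n e\<close> into \<open>c e\<close>.\<close>
      have "(P * C) $$ (i, k) = (\<Sum>l<n. if l = 0 then P $$ (i, 0) * c else 0)"
        unfolding R using ik True by (intro sum.cong) (auto simp: C_def)
      then have "(P * C) $$ (i, k) = P $$ (i, 0) * c" using n by simp
      then show ?thesis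
        unfolding L True pow using ik n carr by (auto simp: P_def)
    next
      case False
      have "(P * C) $$ (i, k) = (\<Sum>l<n. if l = Suc k then P $$ (i, Suc k) else 0)"
        unfolding R using ik False by (intro sum.cong) (auto simp: C_def)
      then have "(P * C) $$ (i, k) = P $$ (i, Suc k)" using ik False by simp
      then show ?thesis unfolding L using ik False by (auto simp: P_def)
    qed
  qed (use carr in auto)
  then show ?thesis
    unfolding C_eq using carr det_krylov_nonzero[OF A]
    by (intro similar_matI_intertwine[of A n C P]) (auto simp: P_def)
qed

section \<open>Commutation relations and \<open>p\<close>-th powers\<close>

text \<open>Since the superdiagonal is nonzero, row \<open>m\<close> of the commutation relation
  expresses row \<open>m + 1\<close> of \<open>E - c\<close> through earlier rows, so the vanishing
  of row 0 propagates downwards.\<close>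

lemma commute_unreduced_hessenberg_scalar:
  fixes A :: "'a :: field mat"
  assumes A: "unreduced_hessenberg n A" and E: "E \<in> carrier_mat n n"
    and comm: "A * E = E * A"
    and row0: "\<And>j. 0 < j \<Longrightarrow> j < n \<Longrightarrow> E $$ (0, j) = 0"
  shows "E = E $$ (0, 0) \<cdot>\<^sub>m 1\<^sub>m n"
proof -
  have carr: "A \<in> carrier_mat n n" and
    zero: "\<And>i j. i < n \<Longrightarrow> j < n \<Longrightarrow> Suc i < j \<Longrightarrow> A $$ (i, j) = 0" and
    nz: "\<And>i. Suc i < n \<Longrightarrow> A $$ (i, Suc i) \<noteq> 0"
    using A by (auto simp: unreduced_hessenberg_def)
  define c where "c = E $$ (0, 0)"
  \<comment> \<open>The entries of \<open>E - c\<close>; scalars commute with \<open>A\<close>, so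
    \<open>d\<close> inherits the relation.\<close>
  define d where "d i j = E $$ (i, j) - (if i = j then c else 0)" for i j
  have comm_d: "(\<Sum>l<n. A $$ (i, l) * d l j) = (\<Sum>l<n. d i l * A $$ (l, j))"
    if ij: "i < n" "j < n" for i j
  proof -
    have "(\<Sum>l<n. A $$ (i, l) * E $$ (l, j)) = (\<Sum>l<n. E $$ (i, l) * A $$ (l, j))"
      using arg_cong[OF comm, of "\<lambda>M. M $$ (i, j)"]
      by (simp only: mult_mat_entry[OF carr E ij] mult_mat_entry[OF E carr ij])
    moreover have "(\<Sum>l<n. A $$ (i, l) * (if l = j then c else 0)) = A $$ (i, j) * c"
      using ij by (simp add: if_distrib[of "\<lambda>x. _ * x"] cong: if_cong)
    moreover have "(\<Sum>l<n. (if i = l then c else 0) * A $$ (l, j)) = c * A $$ (i, j)"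
      using ij by (simp add: if_distrib[of "\<lambda>x. x * _"] cong: if_cong)
    ultimately show ?thesis
      by (simp add: d_def right_diff_distrib left_diff_distrib sum_subtractf)
  qed
  have "\<forall>j<n. d i j = 0" if "i < n" for i
    using that
  proof (induction i rule: less_induct)
    case (less i)
    show ?case
    proof (cases i)
      case 0
      then show ?thesis using row0 by (auto simp: d_def c_def)
    next
      case (Suc m)
      then have m: "m < n" "Suc m < n" using less.prems by auto
      show ?thesis
      proof (intro allI impI)
        fix j assume j: "j < n"
        have "A $$ (m, l) * d l j = 0" if "l < n" "l \<noteq> Suc m" for l
          using zero[OF m(1) that(1)] less.IH[of l] that j Suc by (cases "Suc m < l") auto
        then have "(\<Sum>l<n. A $$ (m, l) * d l j) = A $$ (m, Suc m) * d (Suc m) j"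
          using m(2) by (intro sum_eq_single) auto
        moreover have "(\<Sum>l<n. d m l * A $$ (l, j)) = 0"
          using less.IH[of m] m Suc by (intro sum.neutral) auto
        ultimately show "d i j = 0" using comm_d[OF m(1) j] nz[OF m(2)] Suc by simp
      qed
    qed
  qed
  then have "E $$ (i, j) = (if i = j then c else 0)" if "i < n" "j < n" for i j
    using that by (simp add: d_def)
  then show ?thesis using E unfolding c_def[symmetric] by (intro eq_matI) simp_all
qed

text \<open>The commutator with \<open>S\<close> is a derivation sending \<open>D\<close> to the
  central element \<open>\<alpha>\<close>, so powers obey the rule for differentiating a
  monomial.\<close>

lemma pow_mat_weyl_commutator:
  fixes D :: "'a :: comm_ring_1 mat"
  assumes D: "D \<in> carrier_mat n n" and S: "S \<in> carrier_mat n n"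
    and comm: "D * S = S * D + \<alpha> \<cdot>\<^sub>m 1\<^sub>m n"
  shows "D ^\<^sub>m Suc k * S = S * D ^\<^sub>m Suc k + (of_nat (Suc k) * \<alpha>) \<cdot>\<^sub>m D ^\<^sub>m k"
proof (induction k)
  case 0
  then show ?case using D S comm by simp
next
  case (Suc k)
  let ?T = "D ^\<^sub>m Suc k" and ?K = "D ^\<^sub>m k"
  have c: "?T \<in> carrier_mat n n" "?K \<in> carrier_mat n n" using D by (auto simp del: pow_mat.simps)
  have "D ^\<^sub>m Suc (Suc k) * S = ?T * (D * S)"
    using assoc_mult_mat[OF c(1) D S] by simp
  also have "\<dots> = ?T * (S * D) + ?T * (\<alpha> \<cdot>\<^sub>m 1\<^sub>m n)"
    unfolding comm using c D S by (intro mult_add_distrib_mat[of _ n n]) auto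
  also have "?T * (S * D) = (?T * S) * D"
    by (rule assoc_mult_mat[OF c(1) S D, symmetric])
  also have "\<dots> = S * ?T * D + (of_nat (Suc k) * \<alpha>) \<cdot>\<^sub>m ?K * D"
    unfolding Suc.IH using c D S by (intro add_mult_distrib_mat[of _ n n]) auto
  also have "S * ?T * D = S * D ^\<^sub>m Suc (Suc k)"
    using assoc_mult_mat[OF S c(1) D] by simp
  also have "(of_nat (Suc k) * \<alpha>) \<cdot>\<^sub>m ?K * D = (of_nat (Suc k) * \<alpha>) \<cdot>\<^sub>m ?T"
    using mult_smult_assoc_mat[OF c(2) D] by simp
  also have "?T * (\<alpha> \<cdot>\<^sub>m 1\<^sub>m n) = \<alpha> \<cdot>\<^sub>m ?T"
    using mult_smult_distrib[OF c(1) one_carrier_mat] right_mult_one_mat[OF c(1)]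
    by (simp del: pow_mat.simps)
  \<comment> \<open>The two multiples of \<open>D^(k+1)\<close>, one from the induction hypothesis
    and one from the split-off factor, add up to \<open>(k + 2) \<alpha>\<close>.\<close>
  finally show ?case
    using c D S by (intro eq_matI) (auto simp: algebra_simps simp del: pow_mat.simps index_mult_mat(1))
qed

text \<open>The off-diagonal entries above the diagonal carry binomial coefficients
  \<open>p choose (j - i)\<close> with \<open>0 < j - i < p\<close>, all divisible by
  \<open>p\<close>.\<close>

lemma jordan_block_pow_char:
  fixes a :: "'a :: field"
  assumes p: "Factorial_Ring.prime p" and char: "CHAR('a) = p"
  shows "jordan_block p a ^\<^sub>m p = a ^ p \<cdot>\<^sub>m 1\<^sub>m p"
proof (rule eq_matI)
  fix i j assume "i < dim_row (a ^ p \<cdot>\<^sub>m 1\<^sub>m p)" "j < dim_col (a ^ p \<cdot>\<^sub>m 1\<^sub>m p)"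
  then have ij: "i < p" "j < p" by auto
  have "of_nat (p choose (j - i)) = (0 :: 'a)" if "i < j"
  proof -
    have "p dvd (p choose (j - i))"
      using that ij p by (intro dvd_choose_prime) auto
    then show ?thesis using char of_nat_eq_0_iff_char_dvd by blast
  qed
  then show "(jordan_block p a ^\<^sub>m p) $$ (i, j) = (a ^ p \<cdot>\<^sub>m 1\<^sub>m p) $$ (i, j)"
    using ij by (auto simp: jordan_block_pow)
qed auto

section \<open>The operator \<open>\<alpha> d/dx + g\<close> in characteristic
  \<open>p\<close>\<close>

theorem corollary2p6:
  fixes p :: nat and \<alpha> :: "'a :: field" and \<delta> :: "nat \<Rightarrow> 'a" and D :: "'a mat"
  assumes "Factorial_Ring.prime p" and "CHAR('a) = p" and "\<alpha> \<noteq> 0"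
    and "D = mat p p (\<lambda>(i, j). if j = Suc i then of_nat (Suc i) * \<alpha>
                               else if j < i then \<delta> (i - j) else 0)"
  shows "similar_mat D (companion_mat (Polynomial.monom 1 p - [:det D:])) \<and>
         (perfect_field TYPE('a) \<longrightarrow> similar_mat D (jordan_block p (char_root (det D))))"
proof -
  have p: "p > 1" using assms(1) by (rule prime_gt_1_nat)
  have char0: "of_nat p = (0 :: 'a)" using of_nat_CHAR[where 'a = 'a] assms(2) by simp
  have D: "D \<in> carrier_mat p p" by (simp add: assms(4))
  \<comment> \<open>The superdiagonal factors \<open>1, ..., p - 1\<close> are not divisible by the
    characteristic.\<close>
  have "of_nat (Suc i) \<noteq> (0 :: 'a)" if "Suc i < p" for i
    using that assms(2) of_nat_eq_0_iff_char_dvd[of "Suc i", where 'a = 'a] by (auto dest: dvd_imp_le)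
  then have hess: "unreduced_hessenberg p D"
    using assms(3) by (auto simp: unreduced_hessenberg_def assms(4) simp del: of_nat_Suc)
  define S where "S = mat p p (\<lambda>(i, j). if i = Suc j then 1 else (0 :: 'a))"
  have S: "S \<in> carrier_mat p p" by (simp add: S_def)
  have mult_S: "(M * S) $$ (i, j) = (if Suc j < p then M $$ (i, Suc j) else 0)"
    if "M \<in> carrier_mat p p" "i < p" "j < p" for M :: "'a mat" and i j
  proof -
    have "(M * S) $$ (i, j) = (\<Sum>l<p. if l = Suc j then M $$ (i, Suc j) else 0)"
      unfolding mult_mat_entry[OF that(1) S that(2,3)]
      using that by (intro sum.cong) (auto simp: S_def)
    then show ?thesis by simp
  qed
  have S_mult: "(S * M) $$ (i, j) = (if i = 0 then 0 else M $$ (i - 1, j))"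
    if "M \<in> carrier_mat p p" "i < p" "j < p" for M :: "'a mat" and i j
  proof -
    \<comment> \<open>For \<open>i = 0\<close> the index \<open>i - 1\<close> truncates to 0; the
      inner conditional then makes that term zero.\<close>
    have "(S * M) $$ (i, j) = (\<Sum>l<p. if l = i - 1 then (if i = 0 then 0 else M $$ (i - 1, j)) else 0)"
      unfolding mult_mat_entry[OF S that]
      using that by (intro sum.cong) (auto simp: S_def)
    then show ?thesis using that by auto
  qed
  have comm: "D * S = S * D + \<alpha> \<cdot>\<^sub>m 1\<^sub>m p"
  proof (rule eq_matI)
    fix i j assume "i < dim_row (S * D + \<alpha> \<cdot>\<^sub>m 1\<^sub>m p)" "j < dim_col (S * D + \<alpha> \<cdot>\<^sub>m 1\<^sub>m p)"
    then have ij: "i < p" "j < p" using D S by auto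
    \<comment> \<open>In the last corner \<open>D * S\<close> is 0 while the right-hand side is
      \<open>(p - 1) \<alpha> + \<alpha>\<close>; these agree only because \<open>p = 0\<close> in
      the field.\<close>
    have last: "of_nat j + 1 = (0 :: 'a)" if "Suc j = p"
      using char0 that by (metis of_nat_Suc add.commute)
    then have "of_nat j * \<alpha> + \<alpha> = 0" if "Suc j = p"
      using that by (metis distrib_right mult_1 mult_zero_left)
    then show "(D * S) $$ (i, j) = (S * D + \<alpha> \<cdot>\<^sub>m 1\<^sub>m p) $$ (i, j)"
      using ij mult_S[OF D ij] S_mult[OF D ij] D S
      by (cases i) (auto simp: assms(4) algebra_simps simp del: index_mult_mat(1))
  qed (use D S in auto)
  define E where "E = D ^\<^sub>m p"
  define c where "c = E $$ (0, 0)"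
  have E: "E \<in> carrier_mat p p" using D by (simp add: E_def)
  have "E * S = S * E + (of_nat p * \<alpha>) \<cdot>\<^sub>m D ^\<^sub>m (p - 1)"
    using pow_mat_weyl_commutator[OF D S comm, of "p - 1"] p by (simp add: E_def)
  then have ES: "E * S = S * E"
    using char0 D S E by auto
  \<comment> \<open>Entry \<open>(0, j - 1)\<close> of \<open>E * S\<close> is
    \<open>E $$ (0, j)\<close>, whereas row 0 of \<open>S * E\<close> is zero.\<close>
  have "E $$ (0, j) = 0" if "0 < j" "j < p" for j
    using mult_S[OF E, of 0 "j - 1"] S_mult[OF E, of 0 "j - 1"] that p ES by simp
  moreover have "D * E = E * D"
    using pow_mat_Suc_left[OF D, of p] by (simp add: E_def)
  ultimately have pow: "D ^\<^sub>m p = c \<cdot>\<^sub>m 1\<^sub>m p"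
    using commute_unreduced_hessenberg_scalar[OF hess E] by (simp add: E_def c_def)
  have "det D ^ p = c ^ p"
    using arg_cong[OF pow, of det] by (simp add: det_pow_mat[OF D])
  \<comment> \<open>Injectivity of the Frobenius map cancels the exponent \<open>p\<close>.\<close>
  then have det: "det D = c"
    using power_CHAR_inj[where 'a = 'a] assms(1,2) by auto
  have comp: "similar_mat D (companion_mat (Polynomial.monom 1 p - [:det D:]))"
    using unreduced_hessenberg_similar_companion[OF hess _ pow] p det by simp
  moreover have "similar_mat D (jordan_block p (char_root (det D)))" if "perfect_field TYPE('a)"
  proof -
    let ?J = "jordan_block p (char_root (det D))"
    have "unreduced_hessenberg p ?J" by (auto simp: unreduced_hessenberg_def)
    \<comment> \<open>The eigenvalue is a \<open>p\<close>-th root of \<open>det D\<close>, so the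
      block has the same companion form as \<open>D\<close>.\<close>
    moreover have "?J ^\<^sub>m p = det D \<cdot>\<^sub>m 1\<^sub>m p"
      using jordan_block_pow_char[OF assms(1,2)] char_root_power[of "det D"] assms(1,2) that by simp
    ultimately have "similar_mat ?J (companion_mat (Polynomial.monom 1 p - [:det D:]))"
      using unreduced_hessenberg_similar_companion p by auto
    then show ?thesis using comp similar_mat_sym similar_mat_trans by blast
  qed
  ultimately show ?thesis by blast
qed

end
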